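(* Let $n\ge 3$ and let $\mathbf x_1,\dots,\mathbf x_n$ be a Dziobek configuration in $\mathbb R^{n-2}$, with mutual Euclidean distances $d_{ij}=\|\mathbf x_i-\mathbf x_j\|$. Let $\Gamma$ be the Cayley–Menger determinant. Then, at this configuration, $$\frac{\partial \Gamma}{\partial d_{ij}^2}=(-2)^{n-1}\Delta_i\Delta_j\qquad\text{for all }1\le i<j\le n.$$
   Context: A Dziobek configuration in $\mathbb R^{n-2}$ is a configuration of $n$ points whose affine span is all of $\mathbb R^{n-2}$ (dimension $n-2$). The Cayley–Menger determinant is $$\Gamma=\begin{vmatrix}0&1&1&\cdots&1\\1&0&d_{12}^2&\cdots&d_{1n}^2\\1&d_{21}^2&0&\cdots&d_{2n}^2\\\vdots&\vdots&\vdots&\ddots&\vdots\\1&d_{n1}^2&d_{n2}^2&\cdots&0\end{vmatrix},\qquad d_{ji}=d_{ij},$$ an $(n+1)\times(n+1)$ determinant regarded as a polynomial function of the $\binom n2$ independent variables $d_{ij}^2$, $i<j$ (each appearing in two symmetric positions); the partial derivatives are evaluated at the values given by the configuration. Let $$X=\begin{bmatrix}1&1&\cdots&1\\\mathbf x_1&\mathbf x_2&\cdots&\mathbf x_n\end{bmatrix}$$ (an $(n-1)\times n$ matrix), let $X_k$ be the square matrix obtained from $X$ by deleting the $k$-th column, and $\Delta_k=(-1)^{k-1}\det X_k$. *)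

theory Defs
  imports "HOL-Analysis.Analysis" "Jordan_Normal_Form.Determinant"
begin

text \<open>
  Points of a configuration are numbered \<open>x 1, \<dots>, x n\<close>. The names \<open>mat\<close>, \<open>det\<close> and \<open>$\<close> exist in both
  imported libraries; carrier-based matrices are used for all determinants, since their sizes
  \<open>n + 1\<close> and \<open>n - 1\<close> depend on \<open>n\<close>, and their entries are indexed from 0.
\<close>

definition dziobek_configuration :: "nat \<Rightarrow> (nat \<Rightarrow> real ^ 'd) \<Rightarrow> bool" where
  "dziobek_configuration n x \<longleftrightarrow> CARD('d) = n - 2 \<and> affine hull (x ` {1..n}) = UNIV"

text \<open>
  The Cayley-Menger determinant as a function of the independent variables \<open>s (i, j)\<close>,
  \<open>1 \<le> i < j \<le> n\<close>, standing for the squared distances; no other values of \<open>s\<close> are used.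
  Row and column 0 form the border.
\<close>

definition cayley_menger_mat :: "nat \<Rightarrow> (nat \<times> nat \<Rightarrow> real) \<Rightarrow> real Matrix.mat" where
  "cayley_menger_mat n s = Matrix.mat (n + 1) (n + 1) (\<lambda>(i, j).
     if i = j then 0
     else if i = 0 \<or> j = 0 then 1
     else if i < j then s (i, j)
     else s (j, i))"

definition cayley_menger :: "nat \<Rightarrow> (nat \<times> nat \<Rightarrow> real) \<Rightarrow> real" where
  "cayley_menger n s = Determinant.det (cayley_menger_mat n s)"

definition sq_dists :: "(nat \<Rightarrow> real ^ 'd) \<Rightarrow> nat \<times> nat \<Rightarrow> real" where
  "sq_dists x = (\<lambda>(i, j). (dist (x i) (x j))\<^sup>2)"

text \<open>
  The matrix with columns \<open>(1, x k)\<close>. As the index type \<open>'d\<close> carries no order, \<open>e\<close> lists the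
  coordinates as \<open>e 1, \<dots>, e (n - 2)\<close>.
\<close>

definition config_mat :: "nat \<Rightarrow> (nat \<Rightarrow> 'd) \<Rightarrow> (nat \<Rightarrow> real ^ 'd) \<Rightarrow> real Matrix.mat" where
  "config_mat n e x = Matrix.mat (n - 1) n (\<lambda>(r, c).
     if r = 0 then 1 else vec_nth (x (c + 1)) (e r))"

definition delete_col :: "'a Matrix.mat \<Rightarrow> nat \<Rightarrow> 'a Matrix.mat" where
  "delete_col A k = Matrix.mat (dim_row A) (dim_col A - 1) (\<lambda>(r, c).
     A $$ (r, if c < k then c else c + 1))"

text \<open>The point \<open>x k\<close> sits in column \<open>k - 1\<close>.\<close>

definition Delta :: "nat \<Rightarrow> (nat \<Rightarrow> 'd) \<Rightarrow> (nat \<Rightarrow> real ^ 'd) \<Rightarrow> nat \<Rightarrow> real" where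
  "Delta n e x k = (- 1) ^ (k - 1) * Determinant.det (delete_col (config_mat n e x) (k - 1))"

end

theory Submission
  imports Defs
begin

text \<open>
  By Jacobi's formula and the symmetry of the Cayley-Menger matrix \<open>M\<close>, the derivative is twice the
  cofactor of \<open>M\<close> at \<open>(i, j)\<close>. As \<open>|x\<^sub>r - x\<^sub>c|\<^sup>2 = |x\<^sub>r|\<^sup>2 + |x\<^sub>c|\<^sup>2 - 2 \<langle>x\<^sub>r, x\<^sub>c\<rangle>\<close>, the matrix \<open>M\<close> is a
  product \<open>U W\<close> with inner dimension \<open>n\<close>: the rows of \<open>U\<close> are \<open>(1, 0, 0)\<close> and \<open>(|x\<^sub>r|\<^sup>2, 1, x\<^sub>r)\<close>, the
  columns of \<open>W\<close> are \<open>(0, 1, 0)\<close> and \<open>(1, |x\<^sub>c|\<^sup>2, -2 x\<^sub>c)\<close>. Deleting row \<open>i\<close> of \<open>U\<close> and column \<open>j\<close> of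
  \<open>W\<close> leaves two square matrices, whose determinants are \<open>\<plusminus>\<Delta>\<^sub>i\<close> and \<open>\<plusminus>(-2)\<^sup>n\<^sup>-\<^sup>2 \<Delta>\<^sub>j\<close> by expansion
  along the border.
\<close>

lemma mat_delete_cong_row:
  assumes "A \<in> carrier_mat m m" "B \<in> carrier_mat m m"
    and "\<And>r c. r < m \<Longrightarrow> c < m \<Longrightarrow> r \<noteq> k \<Longrightarrow> A $$ (r, c) = B $$ (r, c)"
  shows "mat_delete A k l = mat_delete B k l"
  using assms by (intro eq_matI) (auto simp: mat_delete_def)

lemma permutes_lessD: "p permutes {0..<m} \<Longrightarrow> i < m \<Longrightarrow> p i < m" for m :: nat
  using permutes_in_image[of p "{0..<m}" i] by simp

text \<open>Jacobi's formula. The product rule turns each Leibniz term into a sum over the row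
  \<open>k\<close> whose factor is differentiated; for fixed \<open>k\<close> these terms form the
  determinant of \<open>A z\<close> with row \<open>k\<close> replaced by derivatives, which is then
  expanded along that row.\<close>

lemma has_real_derivative_det:
  fixes A :: "real \<Rightarrow> real Matrix.mat"
  assumes A: "\<And>t. A t \<in> carrier_mat m m"
    and D: "\<And>r c. r < m \<Longrightarrow> c < m \<Longrightarrow>
      ((\<lambda>t. A t $$ (r, c)) has_real_derivative A' r c) (at z)"
  shows "((\<lambda>t. Determinant.det (A t)) has_real_derivative
    (\<Sum>r<m. \<Sum>c<m. A' r c * Determinant.cofactor (A z) r c)) (at z)"
proof -
  let ?P = "{p. p permutes {0..<m}}"
  let ?R = "\<lambda>k. Matrix.mat m m (\<lambda>(r, c). if r = k then A' r c else A z $$ (r, c))"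
  have "((\<lambda>t. \<Sum>p\<in>?P. signof p * (\<Prod>i=0..<m. A t $$ (i, p i))) has_real_derivative
      (\<Sum>p\<in>?P. signof p * (\<Sum>k=0..<m. A' k (p k) * (\<Prod>i\<in>{0..<m} - {k}. A z $$ (i, p i))))) (at z)"
    by (intro DERIV_sum DERIV_cmult has_field_derivative_prod D)
      (auto simp: permutes_lessD)
  also have "(\<lambda>t. \<Sum>p\<in>?P. signof p * (\<Prod>i=0..<m. A t $$ (i, p i))) = (\<lambda>t. Determinant.det (A t))"
    by (simp add: det_def'[OF A])
  also have "(\<Sum>p\<in>?P. signof p * (\<Sum>k=0..<m. A' k (p k) * (\<Prod>i\<in>{0..<m} - {k}. A z $$ (i, p i))))
      = (\<Sum>p\<in>?P. \<Sum>k=0..<m. signof p * (\<Prod>i=0..<m. ?R k $$ (i, p i)))"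
  proof (intro sum.cong refl, unfold sum_distrib_left, intro sum.cong refl)
    fix p k assume p: "p \<in> ?P" and k: "k \<in> {0..<m}"
    have "(\<Prod>i=0..<m. ?R k $$ (i, p i)) = ?R k $$ (k, p k) * (\<Prod>i\<in>{0..<m} - {k}. ?R k $$ (i, p i))"
      using k by (intro prod.remove) auto
    also have "(\<Prod>i\<in>{0..<m} - {k}. ?R k $$ (i, p i)) = (\<Prod>i\<in>{0..<m} - {k}. A z $$ (i, p i))"
      using p by (intro prod.cong) (auto simp: permutes_lessD)
    also have "?R k $$ (k, p k) = A' k (p k)"
      using p k by (auto simp: permutes_lessD)
    finally show "signof p * (A' k (p k) * (\<Prod>i\<in>{0..<m} - {k}. A z $$ (i, p i)))
      = signof p * (\<Prod>i=0..<m. ?R k $$ (i, p i))" by simp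
  qed
  also have "\<dots> = (\<Sum>k=0..<m. Determinant.det (?R k))"
    by (subst sum.swap, intro sum.cong refl, subst det_def'[of _ m]) auto
  also have "\<dots> = (\<Sum>k<m. \<Sum>c<m. A' k c * Determinant.cofactor (A z) k c)"
    unfolding atLeast0LessThan
  proof (intro sum.cong refl)
    fix k assume k: "k \<in> {..<m}"
    \<comment> \<open>Row \<open>k\<close> is the only one in which \<open>?R k\<close> and
      \<open>A z\<close> differ, so the cofactors along it agree.\<close>
    have "mat_delete (?R k) k c = mat_delete (A z) k c" for c
      by (rule mat_delete_cong_row[of _ m]) (use A in auto)
    then show "Determinant.det (?R k) = (\<Sum>c<m. A' k c * Determinant.cofactor (A z) k c)"
      using k by (subst laplace_expansion_row[of _ m k]) (auto simp: Determinant.cofactor_def)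
  qed
  finally show ?thesis .
qed

lemma det_scale_rows:
  fixes f :: "nat \<Rightarrow> 'a :: comm_ring_1"
  shows "Determinant.det (Matrix.mat m m (\<lambda>(r, c). f r * g r c)) =
    (\<Prod>r=0..<m. f r) * Determinant.det (Matrix.mat m m (\<lambda>(r, c). g r c))"
proof -
  have "(\<Prod>i=0..<m. Matrix.mat m m (\<lambda>(r, c). f r * g r c) $$ (i, p i)) =
      (\<Prod>r=0..<m. f r) * (\<Prod>i=0..<m. Matrix.mat m m (\<lambda>(r, c). g r c) $$ (i, p i))"
    if "p permutes {0..<m}" for p
    unfolding prod.distrib[symmetric] using that by (intro prod.cong) (auto simp: permutes_lessD)
  then show ?thesis
    by (subst (1 2) det_def'[of _ m]) (auto simp: sum_distrib_left mult.left_commute intro!: sum.cong)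
qed

lemma mat_delete_mult:
  assumes "A \<in> carrier_mat (Suc m) k" "B \<in> carrier_mat k (Suc m)" "i \<le> m" "j \<le> m"
  shows "mat_delete (A * B) i j =
    Matrix.mat m k (\<lambda>(r, l). A $$ (if r < i then r else Suc r, l)) *
    Matrix.mat k m (\<lambda>(l, c). B $$ (l, if c < j then c else Suc c))"
  using assms by (intro eq_matI) (auto simp: mat_delete_def scalar_prod_def)

text \<open>Columns 0 and 1 hold the squared norm and the constant 1, so coordinate
  \<open>e (l - 1)\<close> stands in column \<open>l\<close>. Without row 0 and column 0, what
  remains is the transpose of \<open>config_mat\<close>.\<close>

definition left_factor :: "nat \<Rightarrow> (nat \<Rightarrow> 'd) \<Rightarrow> (nat \<Rightarrow> real ^ 'd) \<Rightarrow> real Matrix.mat" where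
  "left_factor n e x = Matrix.mat (n + 1) n (\<lambda>(r, l).
     if r = 0 then if l = 0 then 1 else 0
     else if l = 0 then (norm (x r))\<^sup>2 else if l = 1 then 1 else vec_nth (x r) (e (l - 1)))"

definition right_factor :: "nat \<Rightarrow> (nat \<Rightarrow> 'd) \<Rightarrow> (nat \<Rightarrow> real ^ 'd) \<Rightarrow> real Matrix.mat" where
  "right_factor n e x = Matrix.mat n (n + 1) (\<lambda>(l, c).
     if c = 0 then if l = 1 then 1 else 0
     else if l = 0 then 1 else if l = 1 then (norm (x c))\<^sup>2 else - 2 * vec_nth (x c) (e (l - 1)))"

lemma dist_squared: "(dist a b)\<^sup>2 = (norm a)\<^sup>2 + (norm b)\<^sup>2 - 2 * inner a b"
  for a b :: "'a :: real_inner"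
  by (simp add: dist_norm power2_norm_eq_inner inner_diff_left inner_diff_right inner_commute)

lemma cayley_menger_mat_sq_dists:
  fixes x :: "nat \<Rightarrow> real ^ 'd"
  assumes n: "n \<ge> 2" and e: "bij_betw e {1..n - 2} UNIV"
  shows "cayley_menger_mat n (sq_dists x) = left_factor n e x * right_factor n e x"
    (is "?M = ?U * ?W")
proof (rule eq_matI)
  obtain m where m: "n = Suc (Suc m)"
    using n by (metis add_2_eq_Suc le_Suc_ex)
  have inner: "(\<Sum>l<m. vec_nth a (e (Suc l)) * vec_nth b (e (Suc l))) = inner a b" for a b
  proof -
    have "inner a b = (\<Sum>l\<in>{1..m}. vec_nth a (e l) * vec_nth b (e l))"
      unfolding inner_vec_def using sum.reindex_bij_betw[OF e, symmetric] by (simp add: m)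
    also have "\<dots> = (\<Sum>l<m. vec_nth a (e (Suc l)) * vec_nth b (e (Suc l)))"
      by (simp add: sum.atLeast1_atMost_eq)
    finally show ?thesis ..
  qed
  fix r c assume "r < dim_row (?U * ?W)" "c < dim_col (?U * ?W)"
  then have rc: "r < n + 1" "c < n + 1" by (auto simp: left_factor_def right_factor_def)
  have "(?U * ?W) $$ (r, c) = (\<Sum>l<n. ?U $$ (r, l) * ?W $$ (l, c))"
    using rc by (auto simp: left_factor_def right_factor_def scalar_prod_def atLeast0LessThan)
  also have "\<dots> = ?U $$ (r, 0) * ?W $$ (0, c) + ?U $$ (r, 1) * ?W $$ (1, c)
      + (\<Sum>l<m. ?U $$ (r, Suc (Suc l)) * ?W $$ (Suc (Suc l), c))"
    by (simp add: m sum.lessThan_Suc_shift add.assoc del: sum.lessThan_Suc)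
  also have "\<dots> = (if r = 0 \<and> c = 0 then 0 else if r = 0 \<or> c = 0 then 1
      else (dist (x r) (x c))\<^sup>2)"
    using rc by (auto simp: left_factor_def right_factor_def m dist_squared inner[symmetric]
        sum_distrib_left sum_negf mult.left_commute)
  \<comment> \<open>The zero diagonal of \<open>?M\<close> is the distance of a point to itself;
    below the diagonal, symmetry of \<open>dist\<close> applies.\<close>
  also have "\<dots> = ?M $$ (r, c)"
    using rc by (auto simp: cayley_menger_mat_def sq_dists_def dist_commute)
  finally show "?M $$ (r, c) = (?U * ?W) $$ (r, c)" ..
qed (auto simp: cayley_menger_mat_def left_factor_def right_factor_def)

text \<open>Since \<open>i\<close> is at least 1, the border row (1, 0, ..., 0) survives, and
  expanding along it gives the sign +1.\<close>

lemma det_left_factor_delete_row: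
  assumes "n \<ge> 2" "1 \<le> i" "i \<le> n"
  shows "Determinant.det (Matrix.mat n n (\<lambda>(r, l). left_factor n e x $$ (if r < i then r else Suc r, l)))
    = Determinant.det (delete_col (config_mat n e x) (i - 1))" (is "Determinant.det ?A = _")
proof -
  have "Determinant.det ?A = (\<Sum>l<n. ?A $$ (0, l) * Determinant.cofactor ?A 0 l)"
    using assms by (intro laplace_expansion_row) auto
  also have "\<dots> = (\<Sum>l\<in>{0}. ?A $$ (0, l) * Determinant.cofactor ?A 0 l)"
    using assms by (intro sum.mono_neutral_right) (auto simp: left_factor_def)
  also have "\<dots> = Determinant.det (mat_delete ?A 0 0)"
    using assms by (simp add: left_factor_def Determinant.cofactor_def)
  \<comment> \<open>Dropping the border row lowers all indices by one, so the gap at row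
    \<open>i\<close> becomes the gap at column \<open>i - 1\<close> of
    \<open>config_mat\<close>.\<close>
  also have "mat_delete ?A 0 0 = transpose_mat (delete_col (config_mat n e x) (i - 1))"
    using assms by (intro eq_matI) (auto simp: mat_delete_def delete_col_def config_mat_def left_factor_def)
  also have "Determinant.det \<dots> = Determinant.det (delete_col (config_mat n e x) (i - 1))"
    by (rule det_transpose[of _ "n - 1"]) (auto simp: delete_col_def config_mat_def)
  finally show ?thesis .
qed

text \<open>The surviving border column has its only 1 in row 1, so the expansion picks the cofactor
  at (1, 0), whence the minus sign.\<close>

lemma det_right_factor_delete_col:
  assumes "n \<ge> 2" "1 \<le> j" "j \<le> n"
  shows "Determinant.det (Matrix.mat n n (\<lambda>(l, c). right_factor n e x $$ (l, if c < j then c else Suc c)))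
    = - ((- 2) ^ (n - 2) * Determinant.det (delete_col (config_mat n e x) (j - 1)))"
    (is "Determinant.det ?A = - (_ * Determinant.det ?X)")
proof -
  \<comment> \<open>The row of ones is not scaled, so only \<open>n - 2\<close> of the
    \<open>n - 1\<close> rows contribute a factor -2.\<close>
  let ?f = "\<lambda>r :: nat. if r = 0 then 1 else - 2 :: real"
  have "Determinant.det ?A = (\<Sum>l<n. ?A $$ (l, 0) * Determinant.cofactor ?A l 0)"
    using assms by (intro laplace_expansion_column) auto
  also have "\<dots> = (\<Sum>l\<in>{1}. ?A $$ (l, 0) * Determinant.cofactor ?A l 0)"
    using assms by (intro sum.mono_neutral_right) (auto simp: right_factor_def)
  also have "\<dots> = - Determinant.det (mat_delete ?A 1 0)"
    using assms by (simp add: right_factor_def Determinant.cofactor_def)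
  also have "mat_delete ?A 1 0 = Matrix.mat (n - 1) (n - 1) (\<lambda>(r, c). ?f r * ?X $$ (r, c))"
    using assms by (intro eq_matI) (auto simp: mat_delete_def delete_col_def config_mat_def right_factor_def)
  also have "Determinant.det \<dots> = (\<Prod>r=0..<n - 1. ?f r) *
      Determinant.det (Matrix.mat (n - 1) (n - 1) (\<lambda>(r, c). ?X $$ (r, c)))"
    by (rule det_scale_rows)
  also have "Matrix.mat (n - 1) (n - 1) (\<lambda>(r, c). ?X $$ (r, c)) = ?X"
    by (rule eq_matI) (auto simp: delete_col_def config_mat_def)
  also have "(\<Prod>r=0..<n - 1. ?f r) = (- 2) ^ (n - 2)"
  proof -
    obtain m where "n = Suc (Suc m)"
      using assms(1) by (metis add_2_eq_Suc le_Suc_ex)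
    then show ?thesis
      by (simp add: atLeast0LessThan prod.lessThan_Suc_shift del: prod.lessThan_Suc)
  qed
  finally show ?thesis .
qed

lemma cofactor_cayley_menger_mat:
  fixes x :: "nat \<Rightarrow> real ^ 'd"
  assumes n: "n \<ge> 2" and e: "bij_betw e {1..n - 2} UNIV"
    and ij: "1 \<le> i" "i \<le> n" "1 \<le> j" "j \<le> n"
  shows "Determinant.cofactor (cayley_menger_mat n (sq_dists x)) i j =
    - ((- 2) ^ (n - 2) * Delta n e x i * Delta n e x j)"
proof -
  let ?X = "\<lambda>k. Determinant.det (delete_col (config_mat n e x) (k - 1))"
  let ?U = "Matrix.mat n n (\<lambda>(r, l). left_factor n e x $$ (if r < i then r else Suc r, l))"
  let ?W = "Matrix.mat n n (\<lambda>(l, c). right_factor n e x $$ (l, if c < j then c else Suc c))"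
  have "mat_delete (cayley_menger_mat n (sq_dists x)) i j = ?U * ?W"
    unfolding cayley_menger_mat_sq_dists[OF n e]
    using ij by (intro mat_delete_mult) (auto simp: left_factor_def right_factor_def)
  then have "Determinant.det (mat_delete (cayley_menger_mat n (sq_dists x)) i j) =
      Determinant.det ?U * Determinant.det ?W"
    by (simp add: det_mult[of _ n])
  also have "\<dots> = ?X i * - ((- 2) ^ (n - 2) * ?X j)"
    by (simp only: det_left_factor_delete_row[OF n ij(1,2)] det_right_factor_delete_col[OF n ij(3,4)])
  finally have "Determinant.det (mat_delete (cayley_menger_mat n (sq_dists x)) i j) =
      ?X i * - ((- 2) ^ (n - 2) * ?X j)" .
  \<comment> \<open>The cofactor sign splits into the signs built into \<open>Delta\<close>, the
    exponents differing by 2.\<close>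
  moreover have "(- 1 :: real) ^ (i + j) = (- 1) ^ (i - 1) * (- 1) ^ (j - 1)"
    using ij by (cases i; cases j) (simp_all add: power_add)
  ultimately show ?thesis
    by (simp add: Determinant.cofactor_def Delta_def)
qed

theorem proposition6:
  fixes n :: nat
    and x :: "nat \<Rightarrow> real ^ 'd"
    and e :: "nat \<Rightarrow> 'd"
  assumes "n \<ge> 3"
    and "dziobek_configuration n x"
    and "bij_betw e {1..n - 2} UNIV"
  shows "\<forall>i j. 1 \<le> i \<and> i < j \<and> j \<le> n \<longrightarrow>
    ((\<lambda>t. cayley_menger n ((sq_dists x)((i, j) := t))) has_real_derivative
      (- 2) ^ (n - 1) * Delta n e x i * Delta n e x j) (at (sq_dists x (i, j)))"
proof (intro allI impI)
  fix i j :: nat assume ij: "1 \<le> i \<and> i < j \<and> j \<le> n"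
  let ?z = "sq_dists x (i, j)"
  let ?A = "\<lambda>t. cayley_menger_mat n ((sq_dists x)((i, j) := t))"
  \<comment> \<open>The variable occupies two symmetric entries, which are distinct because
    \<open>i < j\<close>.\<close>
  let ?A' = "\<lambda>r c. if (r, c) \<in> {(i, j), (j, i)} then 1 else 0 :: real"
  let ?C = "Determinant.cofactor (cayley_menger_mat n (sq_dists x))"
  have n: "n \<ge> 2" using assms(1) by simp
  have "((\<lambda>t. ?A t $$ (r, c)) has_real_derivative ?A' r c) (at ?z)" if "r < n + 1" "c < n + 1" for r c
  proof -
    have "?A t $$ (r, c) = (if (r, c) \<in> {(i, j), (j, i)} then t else ?A ?z $$ (r, c))" for t
      using that ij by (auto simp: cayley_menger_mat_def)
    then show ?thesis
      by (auto intro!: derivative_eq_intros)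
  qed
  then have "((\<lambda>t. Determinant.det (?A t)) has_real_derivative
      (\<Sum>r<n + 1. \<Sum>c<n + 1. ?A' r c * Determinant.cofactor (?A ?z) r c)) (at ?z)"
    by (intro has_real_derivative_det) (auto simp: cayley_menger_mat_def)
  also have "?A ?z = cayley_menger_mat n (sq_dists x)" by simp
  also have "(\<Sum>r<n + 1. \<Sum>c<n + 1. ?A' r c * ?C r c) =
      (\<Sum>(r, c)\<in>{..<n + 1} \<times> {..<n + 1}. ?A' r c * ?C r c)"
    by (rule sum.cartesian_product)
  also have "\<dots> = (\<Sum>(r, c)\<in>{(i, j), (j, i)}. ?A' r c * ?C r c)"
    using ij by (intro sum.mono_neutral_right) (auto split: if_splits)
  also have "\<dots> = ?C i j + ?C j i"
    using ij by simp
  \<comment> \<open>The cofactor formula is symmetric in \<open>i\<close> and \<open>j\<close>, so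
    both terms agree; doubling and the minus sign together supply the last factor -2.\<close>
  also have "\<dots> = - 2 * (- 2) ^ (n - 2) * Delta n e x i * Delta n e x j"
    using ij by (simp add: cofactor_cayley_menger_mat[OF n assms(3)])
  also have "- 2 * (- 2 :: real) ^ (n - 2) = (- 2) ^ (n - 1)"
    by (simp flip: power_Suc add: Suc_diff_Suc n[unfolded numeral_2_eq_2 Suc_le_eq] numeral_2_eq_2)
  finally show "((\<lambda>t. cayley_menger n ((sq_dists x)((i, j) := t))) has_real_derivative
      (- 2) ^ (n - 1) * Delta n e x i * Delta n e x j) (at ?z)"
    unfolding cayley_menger_def .
qed

end
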